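(* Let $p$ be a prime and let $\lambda$ be a symmetric partition with non-empty $p$-core $\lambda^0$ and $p$-quotient $(\lambda_0,\dots,\lambda_{p-1})$. Let $\bar\lambda$ be the symmetric partition with empty $p$-core and the same $p$-quotient as $\lambda$. Then the set $\delta(\lambda)$ of diagonal hook lengths of $\lambda$ is $$\delta(\lambda)=\mathbb O_1\cup\mathbb O_2\cup\mathbb O_3\cup\mathbb O_4,$$ where $$\mathbb O_1=\bigcup_{\gamma'\in\Omega'}\{2(\gamma'+(\sigma+d^0_{\gamma'})p)+1:\ \sigma\in D_{\gamma'}(\bar\lambda)_R\},$$ $$\mathbb O_2=\bigcup_{\gamma'\in\Omega'}\{2(\gamma'+(d^0_{\gamma'}-s-1)p)+1:\ s\in S_{\gamma'}(\bar\lambda)_L\},$$ $$\mathbb O_3=\bigcup_{\gamma'\in\Omega'}\{2((p-1-\gamma')+(t-d^0_{\gamma'})p)+1:\ t\in T_{\gamma'}(\bar\lambda)_L\},$$ $$\mathbb O_4=\bigcup_{\gamma''\in\Omega''}\{2(\gamma''+\mu p)+1:\ \mu\in D_{\gamma''}(\bar\lambda)_R\}.$$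
   Context: $\mathbb N=\{0,1,2,\dots\}$. A partition is symmetric if it equals its dual (conjugate). A $\beta$-set of a partition $\lambda$ is a set $X=\{\ell_i+k-i:1\le i\le k\}$ where $\lambda=(\ell_1\ge\dots\ge \ell_k\ge 0)$ (zero parts allowed). The $p$-core $\lambda^0$ of $\lambda$ is the partition obtained by successively removing hooks of length $p$ until none is left. The $p$-quotient $(\lambda_0,\dots,\lambda_{p-1})$ is obtained from a $\beta$-set $X$ of $\lambda$ with $|X|\equiv 0\pmod p$: $\lambda_\gamma$ is the partition with $\beta$-set $X_\gamma=\{j:\gamma+jp\in X\}$. The diagonal hooks of $\lambda$ are the hooks $h_{ii}$ with corner on the main diagonal of the Young diagram; $\delta(\lambda)$ is the set of their lengths. $D(\lambda)=(\alpha_1,\dots,\alpha_t|\beta_1,\dots,\beta_t)$, where $\alpha_i$ and $\beta_i$ are the leg and arm lengths of $h_{ii}$; $D(\lambda)_L=(\alpha_1,\dots,\alpha_t)$, $D(\lambda)_R=(\beta_1,\dots,\beta_t)$ (regarded as sets when convenient). For $0\le\gamma\le p-1$, $D_\gamma(\lambda)$ consists of two sets of non-negative integers: $D_\gamma(\lambda)_L=\{m\ge0: (p-1-\gamma)+mp\in D(\lambda)_L\}$ and $D_\gamma(\lambda)_R=\{m\ge0:\gamma+mp\in D(\lambda)_R\}$. $D(\lambda^0)_\gamma$ is the set of pairs $(\beta|\beta)$ in $D(\lambda^0)$ (i.e. $\beta$ is the common arm and leg length of a diagonal hook of $\lambda^0$) with $\beta\equiv\gamma\pmod p$, and $d^0_\gamma=|D(\lambda^0)_\gamma|$.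 $\Omega'=\{\gamma'\in\{0,\dots,p-1\}: d^0_{\gamma'}>0\}$, $(\Omega')^*=\{p-1-\gamma':\gamma'\in\Omega'\}$, and $\Omega''=\{0,\dots,p-1\}\setminus(\Omega'\cup(\Omega')^* )$. For $\gamma'\in\Omega'$: $S_{\gamma'}(\bar\lambda)_L=\{s\in\mathbb N: s\notin D_{\gamma'}(\bar\lambda)_L,\ 0\le s\le d^0_{\gamma'}-1\}$ and $T_{\gamma'}(\bar\lambda)_L=\{t\in D_{\gamma'}(\bar\lambda)_L: t\ge d^0_{\gamma'}\}$. *)

theory Defs
  imports "HOL-Computational_Algebra.Primes" "HOL-Number_Theory.Cong"
begin

text \<open>
  A partition is the weakly decreasing list of its positive parts. Rows and columns of Young
  diagrams are numbered from 0.
\<close>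

definition is_partition :: "nat list \<Rightarrow> bool" where
  "is_partition l \<longleftrightarrow> sorted_wrt (\<ge>) l \<and> (\<forall>x\<in>set l. 0 < x)"

definition young :: "nat list \<Rightarrow> (nat \<times> nat) set" where
  "young l = {(i, j). i < length l \<and> j < l ! i}"

definition conjugate :: "nat list \<Rightarrow> nat list" where
  "conjugate l = map (\<lambda>j. card {i. (i, j) \<in> young l}) [0..<(if l = [] then 0 else hd l)]"

definition symmetric_partition :: "nat list \<Rightarrow> bool" where
  "symmetric_partition l \<longleftrightarrow> is_partition l \<and> conjugate l = l"

definition arm :: "nat list \<Rightarrow> nat \<Rightarrow> nat \<Rightarrow> nat" where
  "arm l i j = card {b. j < b \<and> (i, b) \<in> young l}"

definition leg :: "nat list \<Rightarrow> nat \<Rightarrow> nat \<Rightarrow> nat" where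
  "leg l i j = card {a. i < a \<and> (a, j) \<in> young l}"

definition hook_length :: "nat list \<Rightarrow> nat \<Rightarrow> nat \<Rightarrow> nat" where
  "hook_length l i j = arm l i j + leg l i j + 1"

text \<open>
  Removing the hook with corner (i, j) means deleting the nodes of that hook and closing up the
  diagram, that is, moving every node strictly below and to the right of (i, j) one step up
  and one step left. The diagram which results is the original one without the part of
  its rim described here (the rim hook belonging to (i, j)).
\<close>

definition rim_hook :: "nat list \<Rightarrow> nat \<Rightarrow> nat \<Rightarrow> (nat \<times> nat) set" where
  "rim_hook l i j = {(a, b) \<in> young l. i \<le> a \<and> j \<le> b \<and> (Suc a, Suc b) \<notin> young l}"

definition removes_hook :: "nat \<Rightarrow> nat list \<Rightarrow> nat list \<Rightarrow> bool" where
  "removes_hook p l m \<longleftrightarrow> is_partition m \<and>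
     (\<exists>i j. (i, j) \<in> young l \<and> hook_length l i j = p \<and> young m = young l - rim_hook l i j)"

definition is_core :: "nat \<Rightarrow> nat list \<Rightarrow> nat list \<Rightarrow> bool" where
  "is_core p l c \<longleftrightarrow> (removes_hook p)\<^sup>*\<^sup>* l c \<and> (\<forall>(i, j)\<in>young c. hook_length c i j \<noteq> p)"

text \<open>With parts numbered from 0, the entry belonging to part \<open>l ! i\<close> of \<open>k\<close> parts is \<open>l ! i + k - (i + 1)\<close>.\<close>

definition beta_numbers :: "nat list \<Rightarrow> nat set" where
  "beta_numbers l = {l ! i + length l - (i + 1) | i. i < length l}"

definition is_beta_set :: "nat list \<Rightarrow> nat set \<Rightarrow> bool" where
  "is_beta_set l X \<longleftrightarrow> is_partition l \<and> (\<exists>m. X = beta_numbers (l @ replicate m 0))"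

text \<open>The quotient \<open>q\<close> does not depend on the choice of \<open>X\<close>, as long as \<open>p\<close> divides \<open>card X\<close>.\<close>

definition is_quotient :: "nat \<Rightarrow> nat list \<Rightarrow> nat list list \<Rightarrow> bool" where
  "is_quotient p l q \<longleftrightarrow> length q = p \<and>
     (\<exists>X. is_beta_set l X \<and> [card X = 0] (mod p) \<and>
          (\<forall>\<gamma><p. is_beta_set (q ! \<gamma>) {j. \<gamma> + j * p \<in> X}))"

definition diag_hook_lengths :: "nat list \<Rightarrow> nat set" where
  "diag_hook_lengths l = {hook_length l i i | i. (i, i) \<in> young l}"

text \<open>The pairs consist of a leg length followed by an arm length, in this order.\<close>

definition diag :: "nat list \<Rightarrow> (nat \<times> nat) set" where
  "diag l = {(leg l i i, arm l i i) | i. (i, i) \<in> young l}"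

definition diag_L :: "nat list \<Rightarrow> nat set" where
  "diag_L l = fst ` diag l"

definition diag_R :: "nat list \<Rightarrow> nat set" where
  "diag_R l = snd ` diag l"

definition res_L :: "nat \<Rightarrow> nat list \<Rightarrow> nat \<Rightarrow> nat set" where
  "res_L p l \<gamma> = {m. (p - 1 - \<gamma>) + m * p \<in> diag_L l}"

definition res_R :: "nat \<Rightarrow> nat list \<Rightarrow> nat \<Rightarrow> nat set" where
  "res_R p l \<gamma> = {m. \<gamma> + m * p \<in> diag_R l}"

text \<open>In what follows \<open>c\<close> stands for the core and \<open>lb\<close> for the partition with empty core.\<close>

definition core_diag :: "nat \<Rightarrow> nat list \<Rightarrow> nat \<Rightarrow> (nat \<times> nat) set" where
  "core_diag p c \<gamma> = {(\<beta>, \<beta>) | \<beta>. (\<beta>, \<beta>) \<in> diag c \<and> [\<beta> = \<gamma>] (mod p)}"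

definition core_d :: "nat \<Rightarrow> nat list \<Rightarrow> nat \<Rightarrow> nat" where
  "core_d p c \<gamma> = card (core_diag p c \<gamma>)"

definition Omega1 :: "nat \<Rightarrow> nat list \<Rightarrow> nat set" where
  "Omega1 p c = {\<gamma> \<in> {0..<p}. core_d p c \<gamma> > 0}"

definition Omega1_star :: "nat \<Rightarrow> nat list \<Rightarrow> nat set" where
  "Omega1_star p c = {p - 1 - \<gamma> | \<gamma>. \<gamma> \<in> Omega1 p c}"

definition Omega2 :: "nat \<Rightarrow> nat list \<Rightarrow> nat set" where
  "Omega2 p c = {0..<p} - (Omega1 p c \<union> Omega1_star p c)"

definition S_L :: "nat \<Rightarrow> nat list \<Rightarrow> nat list \<Rightarrow> nat \<Rightarrow> nat set" where
  "S_L p c lb \<gamma> = {s. s \<notin> res_L p lb \<gamma> \<and> s < core_d p c \<gamma>}"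

definition T_L :: "nat \<Rightarrow> nat list \<Rightarrow> nat list \<Rightarrow> nat \<Rightarrow> nat set" where
  "T_L p c lb \<gamma> = {t \<in> res_L p lb \<gamma>. t \<ge> core_d p c \<gamma>}"

end

theory Submission
  imports Defs
begin

text \<open>
  Attach to \<open>l\<close> the set of beads \<open>l\<^sub>i - i - 1\<close> on the integers. Non-negative beads are the arm lengths of
  diagonal hooks, and a gap at \<open>- 1 - b\<close> is a leg length \<open>b\<close>; symmetry means that \<open>z \<mapsto> - 1 - z\<close>
  exchanges beads and gaps. Removing a \<open>p\<close>-hook moves a bead from \<open>z\<close> to a gap at \<open>z - p\<close>, hence
  preserves the charge of each residue class mod \<open>p\<close>. In the core the class of \<open>\<gamma>\<close> is the half line
  below its charge \<open>c \<gamma>\<close>, so that \<open>d\<^sup>0\<^sub>\<gamma> = max 0 (c \<gamma>)\<close>, and symmetry gives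
  \<open>c (p - 1 - \<gamma>) = - c \<gamma>\<close>. The quotient determines each class up to a shift, so the class of \<open>\<gamma>\<close> in \<open>l\<close>
  is that of \<open>lb\<close> shifted by \<open>c \<gamma>\<close>. The four sets arise from the sign of \<open>c \<gamma>\<close> and, if it is positive,
  from the sign of the position before the shift.
\<close>

subsection \<open>Beads of a partition\<close>

text \<open>Zero beyond the last part, so that every natural number indexes a row and no number of
  zero parts has to be chosen.\<close>

definition part :: "nat list \<Rightarrow> nat \<Rightarrow> nat" where
  "part l i = (if i < length l then l ! i else 0)"

definition height :: "nat list \<Rightarrow> nat \<Rightarrow> nat" where
  "height l j = card {i. j < part l i}"

text \<open>A beta set with infinitely many zero parts, normalised so that the empty partition
  occupies exactly the negative integers.\<close>

definition maya :: "nat list \<Rightarrow> int set" where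
  "maya l = range (\<lambda>i. int (part l i) - int i - 1)"

text \<open>A runner of the abacus with p runners. Positions range over all integers, so that shifts
  in both directions make sense.\<close>

definition runner :: "nat \<Rightarrow> nat \<Rightarrow> int set \<Rightarrow> int set" where
  "runner p \<gamma> M = {j. int \<gamma> + j * int p \<in> M}"

lemma mem_young_iff: "(i, j) \<in> young l \<longleftrightarrow> j < part l i"
  by (auto simp: young_def part_def)

lemma part_antimono:
  assumes "is_partition l" "a \<le> b"
  shows "part l b \<le> part l a"
proof (cases "a = b \<or> b \<ge> length l")
  case True
  then show ?thesis by (auto simp: part_def)
next
  case False
  with assms have "sorted_wrt (\<ge>) l" "a < b" "b < length l" by (auto simp: is_partition_def)
  from sorted_wrt_nth_less[OF this] show ?thesis using False assms by (simp add: part_def)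
qed

text \<open>Since parts decrease, the rows that reach column j form an initial segment. This turns
  statements about cells into linear inequalities between rows and columns.\<close>

lemma less_part_iff_less_height:
  assumes "is_partition l"
  shows "j < part l i \<longleftrightarrow> i < height l j"
proof -
  have fin: "\<exists>n. \<not> j < part l n" by (rule exI[of _ "length l"]) (simp add: part_def)
  define n where "n = (LEAST n. \<not> j < part l n)"
  have 1: "\<not> j < part l n" unfolding n_def by (rule LeastI_ex[OF fin])
  have 2: "j < part l i" if "i < n" for i using not_less_Least[of i] that unfolding n_def by blast
  have eq: "{i. j < part l i} = {..<n}"
    using 1 2 part_antimono[OF assms] by (auto simp: not_less) (meson leI le_trans not_less)
  then have "height l j = n" by (simp add: height_def)
  with eq show ?thesis by auto
qed

lemma arm_eq: "arm l i j = part l i - j - 1"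
proof -
  have "{b. j < b \<and> (i, b) \<in> young l} = {j<..<part l i}" by (auto simp: mem_young_iff)
  then show ?thesis by (simp add: arm_def)
qed

lemma leg_eq:
  assumes "is_partition l"
  shows "leg l i j = height l j - i - 1"
proof -
  have "{a. i < a \<and> (a, j) \<in> young l} = {i<..<height l j}"
    by (auto simp: mem_young_iff less_part_iff_less_height[OF assms])
  then show ?thesis by (simp add: leg_def)
qed

text \<open>Rows account for the beads, columns for the gaps.\<close>

lemma not_mem_maya_iff:
  assumes "is_partition l"
  shows "z \<notin> maya l \<longleftrightarrow> (\<exists>j. z = int j - int (height l j))"
proof
  assume z: "z \<notin> maya l"
  let ?P = "\<lambda>i. int (part l i) - int i - 1 < z"
  have "?P (length l + nat \<bar>z\<bar>)" by (simp add: part_def)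
  then have ex: "\<exists>i. ?P i" by blast
  \<comment> \<open>The first row whose bead lies strictly left of z. The gap at z will belong to
    column z + i.\<close>
  define i where "i = (LEAST i. ?P i)"
  have i: "?P i" unfolding i_def by (rule LeastI_ex[OF ex])
  have less: "\<not> ?P a" if "a < i" for a using not_less_Least[of a] that unfolding i_def by blast
  define j where "j = nat (z + int i)"
  have j: "int j = z + int i" using i by (simp add: j_def)
  \<comment> \<open>Row i stops before column j. Row i - 1 has its bead strictly right of the gap z,
    so it reaches column j, as do all rows above it.\<close>
  have "a < height l j \<longleftrightarrow> a < i" for a
  proof -
    have "\<not> j < part l i" using i j by linarith
    moreover have "j < part l a" if "a < i"
    proof -
      have "int (part l (i - 1)) - int (i - 1) - 1 \<noteq> z" using z by (auto simp: maya_def)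
      moreover have "\<not> ?P (i - 1)" using that by (intro less) simp
      ultimately have "j < part l (i - 1)" using j that by linarith
      also have "\<dots> \<le> part l a" using that by (intro part_antimono[OF assms]) simp
      finally show ?thesis .
    qed
    ultimately show ?thesis
      using less_part_iff_less_height[OF assms] by (meson leI le_less_trans)
  qed
  then have "height l j = i" by (meson nat_neq_iff)
  with j show "\<exists>j. z = int j - int (height l j)" by (intro exI[of _ j]) simp
next
  assume "\<exists>j. z = int j - int (height l j)"
  then obtain j where j: "z = int j - int (height l j)" by blast
  have "z \<noteq> int (part l i) - int i - 1" for i
    using less_part_iff_less_height[OF assms, of j i] j by (cases "i < height l j") auto
  then show "z \<notin> maya l" by (auto simp: maya_def)
qed

text \<open>The bead of row i is non-negative exactly if the row meets the diagonal, and it is then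
  the arm length there.\<close>

lemma mem_diag_R_iff: "b \<in> diag_R l \<longleftrightarrow> int b \<in> maya l"
proof
  assume "b \<in> diag_R l"
  then obtain i where "i < part l i" "b = part l i - i - 1"
    by (auto simp: diag_R_def diag_def mem_young_iff arm_eq)
  then have "int b = int (part l i) - int i - 1" by simp
  then show "int b \<in> maya l" by (simp add: maya_def)
next
  assume "int b \<in> maya l"
  then obtain i where "int b = int (part l i) - int i - 1" by (auto simp: maya_def)
  then have "i < part l i" "b = part l i - i - 1" by linarith+
  then show "b \<in> diag_R l" 
    by (force simp: diag_R_def diag_def mem_young_iff arm_eq)
qed

text \<open>The gap of column i is negative exactly if the column meets the diagonal, and it is then
  - 1 minus the leg length there.\<close>

lemma mem_diag_L_iff:
  assumes "is_partition l"
  shows "b \<in> diag_L l \<longleftrightarrow> - 1 - int b \<notin> maya l"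
proof
  assume "b \<in> diag_L l"
  then obtain i where "i < height l i" "b = height l i - i - 1"
    by (auto simp: diag_L_def diag_def mem_young_iff less_part_iff_less_height[OF assms] leg_eq[OF assms])
  then have "- 1 - int b = int i - int (height l i)" by simp
  then show "- 1 - int b \<notin> maya l" using not_mem_maya_iff[OF assms] by blast
next
  assume "- 1 - int b \<notin> maya l"
  then obtain i where "- 1 - int b = int i - int (height l i)"
    using not_mem_maya_iff[OF assms] by blast
  then have "i < height l i" "b = height l i - i - 1" by linarith+
  then show "b \<in> diag_L l" 
    by (force simp: diag_L_def diag_def mem_young_iff less_part_iff_less_height[OF assms] leg_eq[OF assms])
qed

section \<open>Symmetric partitions and the reflection of beads\<close>

lemma symmetric_partition_arm_eq_leg:
  assumes "symmetric_partition l" "i < part l i"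
  shows "arm l i i = leg l i i"
proof -
  have l: "is_partition l" and c: "conjugate l = l" using assms by (auto simp: symmetric_partition_def)
  from assms(2) have ne: "l \<noteq> []" by (auto simp: part_def split: if_splits)
  have "length l = hd l" using arg_cong[OF c, of length] ne by (simp add: conjugate_def)
  moreover have "i < length l" using assms(2) by (auto simp: part_def split: if_splits)
  ultimately have "conjugate l ! i = height l i"
    using ne by (simp add: conjugate_def height_def mem_young_iff)
  then have "part l i = height l i" using c \<open>i < length l\<close> by (simp add: part_def)
  then show ?thesis by (simp add: arm_eq leg_eq[OF l])
qed

lemma symmetric_partition_diag_L_eq_diag_R:
  assumes "symmetric_partition l"
  shows "diag_L l = diag_R l"
proof -
  have "fst x = snd x" if "x \<in> diag l" for x
    using that symmetric_partition_arm_eq_leg[OF assms] by (auto simp: diag_def mem_young_iff)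
  then show ?thesis by (auto simp: diag_L_def diag_R_def image_def)
qed

lemma symmetric_partition_maya:
  assumes "symmetric_partition l"
  shows "- 1 - z \<in> maya l \<longleftrightarrow> z \<notin> maya l"
proof -
  have l: "is_partition l" using assms by (simp add: symmetric_partition_def)
  \<comment> \<open>\<open>diag_L\<close> sees the negative positions and \<open>diag_R\<close> the
    others, so their equality is the claim for z >= 0. For negative z, apply it to - 1 - z.\<close>
  have *: "- 1 - int n \<in> maya l \<longleftrightarrow> int n \<notin> maya l" for n
    using symmetric_partition_diag_L_eq_diag_R[OF assms] mem_diag_L_iff[OF l, of n] mem_diag_R_iff[of n l]
    by auto
  show ?thesis
  proof (cases "z \<ge> 0")
    case True
    then show ?thesis using *[of "nat z"] by simp
  next
    case False
    then show ?thesis using *[of "nat (- 1 - z)"] by simp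
  qed
qed

lemma symmetric_partition_diag_hook_lengths:
  assumes "symmetric_partition l"
  shows "diag_hook_lengths l = {2 * b + 1 | b. b \<in> diag_R l}"
  using symmetric_partition_arm_eq_leg[OF assms]
  by (force simp: diag_hook_lengths_def hook_length_def diag_R_def diag_def mem_young_iff)

text \<open>Arms and legs both decrease strictly along the diagonal, so their sets determine the pairing.\<close>

lemma maya_symmetric_imp_arm_eq_leg:
  assumes l: "is_partition l" and sym: "\<And>z. - 1 - z \<in> maya l \<longleftrightarrow> z \<notin> maya l" and "i < part l i"
  shows "arm l i i = leg l i i"
proof -
  have fin: "\<exists>n. \<not> n < part l n" by (rule exI[of _ "length l"]) (simp add: part_def)
  \<comment> \<open>The side of the Durfee square, that is, the number of diagonal cells.\<close>
  define t where "t = (LEAST n. \<not> n < part l n)"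
  have "\<not> t < part l t" unfolding t_def by (rule LeastI_ex[OF fin])
  then have t: "n < part l n \<longleftrightarrow> n < t" for n
    using not_less_Least[of n "\<lambda>n. \<not> n < part l n"] part_antimono[OF l, of t n] unfolding t_def[symmetric]
    by (meson le_trans not_less)
  have LR: "diag_L l = diag_R l" using sym by (auto simp: mem_diag_L_iff[OF l] mem_diag_R_iff)
  have hp: "n < height l n" if "n < t" for n
    using that t less_part_iff_less_height[OF l] by blast
  have hanti: "height l b \<le> height l a" if "a \<le> b" for a b
    using that less_part_iff_less_height[OF l] by (meson le_less_trans not_le order.refl)
  \<comment> \<open>Reversal makes both lists strictly increasing, and such a list is determined by
    its set of entries.\<close>
  define A where "A = map (\<lambda>i. part l i - i - 1) (rev [0..<t])"
  define B where "B = map (\<lambda>i. height l i - i - 1) (rev [0..<t])"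
  have arm_mono: "part l b - b - 1 < part l a - a - 1" if "a < b" "b < t" for a b
    using t[of b] part_antimono[OF l, of a b] that by linarith
  have leg_mono: "height l b - b - 1 < height l a - a - 1" if "a < b" "b < t" for a b
    using hp[of b] hanti[of a b] that by linarith
  have upt: "sorted_wrt (\<lambda>x y. x < y \<and> y < t) [0..<t]"
    by (simp add: sorted_wrt_iff_nth_less)
  have "sorted_wrt (<) A" "sorted_wrt (<) B" unfolding A_def B_def sorted_wrt_map sorted_wrt_rev
    by (rule sorted_wrt_mono_rel[OF _ upt], use arm_mono leg_mono in blast)+
  moreover have "set A = diag_R l"
    by (force simp: A_def diag_R_def diag_def mem_young_iff arm_eq t)
  moreover have "set B = diag_L l"
    by (force simp: B_def diag_L_def diag_def mem_young_iff leg_eq[OF l] t)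
  ultimately have "A = B" using LR by (simp add: strict_sorted_equal)
  then show ?thesis using assms(3) t by (auto simp: A_def B_def arm_eq leg_eq[OF l])
qed

subsection \<open>Hook removal\<close>

text \<open>Let h be the height of column j. Closing up the diagram gives each of the rows i to h -
  2 the length of the next row minus 1, hence the bead of that next row, and gives row h - 1 the
  length j, hence the bead j - h. So the bead of row i disappears, the gap of column j is filled,
  and the other beads at most change rows.\<close>

lemma maya_removes_hook:
  assumes l: "is_partition l" and r: "removes_hook p l m"
  obtains z where "z \<in> maya l" "z - int p \<notin> maya l"
    "maya m = insert (z - int p) (maya l - {z})"
proof -
  from r obtain i j where ij: "j < part l i" and hl: "hook_length l i j = p"
    and y: "young m = young l - rim_hook l i j"
    by (auto simp: removes_hook_def mem_young_iff)
  define h where "h = height l j"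
  have h: "j < part l a \<longleftrightarrow> a < h" for a
    unfolding h_def by (rule less_part_iff_less_height[OF l])
  have ih: "i < h" using ij h by blast
  have pm: "b < part m a \<longleftrightarrow> b < part l a \<and> \<not> (i \<le> a \<and> j \<le> b \<and> \<not> Suc b < part l (Suc a))" for a b
    using y by (auto simp: set_eq_iff rim_hook_def mem_young_iff)
  have eqI: "x = y" if "\<And>b. b < x \<longleftrightarrow> b < y" for x y :: nat
    using that by (meson nat_neq_iff)
  have out: "part m a = part l a" if "a < i \<or> a \<ge> h" for a
  proof (rule eqI)
    fix b
    have "\<not> (i \<le> a \<and> j \<le> b \<and> b < part l a)" using that h[of a] by linarith
    then show "b < part m a \<longleftrightarrow> b < part l a" by (auto simp: pm)
  qed
  have mid: "part m a = part l (Suc a) - 1" if "i \<le> a" "Suc a < h" for a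
  proof (rule eqI)
    have "j < part l (Suc a)" using h that by blast
    moreover have "part l (Suc a) \<le> part l a" by (rule part_antimono[OF l]) simp
    ultimately show "b < part m a \<longleftrightarrow> b < part l (Suc a) - 1" for b
      using that by (auto simp: pm)
  qed
  have last: "part m (h - 1) = j"
  proof (rule eqI)
    have "\<not> j < part l h" "j < part l (h - 1)" using h ih by simp_all
    then show "b < part m (h - 1) \<longleftrightarrow> b < j" for b using ih by (auto simp: pm)
  qed
  let ?f = "\<lambda>a. int (part l a) - int a - 1" and ?g = "\<lambda>a. int (part m a) - int a - 1"
  define z where "z = ?f i"
  \<comment> \<open>The hook length is the bead of row i minus the gap of column j.\<close>
  have zp: "z - int p = int j - int h"
    using hl ij ih by (simp add: z_def hook_length_def arm_eq leg_eq[OF l] h_def[symmetric])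
  have "z \<in> maya l" by (auto simp: z_def maya_def)
  moreover have "z - int p \<notin> maya l" using zp not_mem_maya_iff[OF l] by (auto simp: h_def)
  moreover have "maya m = insert (z - int p) (maya l - {z})"
  proof -
    have inj: "a = b" if "?f a = ?f b" for a b
      using part_antimono[OF l, of a b] part_antimono[OF l, of b a] that by linarith
    have g_out: "?g a = ?f a" if "a < i \<or> a \<ge> h" for a using out that by simp
    have g_mid: "?g a = ?f (Suc a)" if "i \<le> a" "Suc a < h" for a
    proof -
      have "j < part l (Suc a)" using h that by blast
      then show ?thesis using mid[OF that] by simp
    qed
    have g_last: "?g (h - 1) = z - int p" using last ih by (simp add: zp)
    show ?thesis
    proof (intro equalityI subsetI)
      fix x assume "x \<in> maya m"
      then obtain a where a: "x = ?g a" by (auto simp: maya_def)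
      consider "a < i \<or> a \<ge> h" | "i \<le> a" "Suc a < h" | "a = h - 1" using ih by linarith
      then show "x \<in> insert (z - int p) (maya l - {z})"
      proof cases
        case 1
        then have "x = ?f a" "a \<noteq> i" using a g_out ih by auto
        then show ?thesis using inj by (auto simp: maya_def z_def)
      next
        case 2
        then have "x = ?f (Suc a)" "Suc a \<noteq> i" using a g_mid by auto
        moreover have "?f (Suc a) \<in> maya l" unfolding maya_def by blast
        ultimately show ?thesis using inj[of "Suc a" i] by (auto simp: z_def)
      next
        case 3
        then show ?thesis using a g_last by simp
      qed
    next
      fix x assume x: "x \<in> insert (z - int p) (maya l - {z})"
      have ran: "?g a \<in> maya m" for a by (auto simp: maya_def)
      show "x \<in> maya m"
      proof (cases "x = z - int p")
        case True
        then show ?thesis using g_last ran by metis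
      next
        case False
        with x obtain a where a: "x = ?f a" "a \<noteq> i" by (auto simp: maya_def z_def)
        show ?thesis
        proof (cases "a < i \<or> a \<ge> h")
          case True
          then show ?thesis using g_out a ran by metis
        next
          case False
          then have "i \<le> a - 1" "Suc (a - 1) < h" "Suc (a - 1) = a" using a by auto
          then show ?thesis using g_mid a ran by metis
        qed
      qed
    qed
  qed
  ultimately show ?thesis by (rule that)
qed

text \<open>If the bead of row i had the gap of some column j exactly p places to its left, then row
  i would reach column j and the hook at (i, j) would have length p.\<close>

lemma maya_no_hook_closed:
  assumes l: "is_partition l" and "p > 0" and no: "\<forall>(i, j)\<in>young l. hook_length l i j \<noteq> p"
    and z: "z \<in> maya l"
  shows "z - int p \<in> maya l"
proof (rule ccontr)
  assume "z - int p \<notin> maya l"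
  then obtain j where j: "z - int p = int j - int (height l j)" using not_mem_maya_iff[OF l] by blast
  from z obtain i where i: "z = int (part l i) - int i - 1" by (auto simp: maya_def)
  have ij: "j < part l i"
    using less_part_iff_less_height[OF l, of j i] i j \<open>p > 0\<close> by (cases "i < height l j") auto
  then have "i < height l j" using less_part_iff_less_height[OF l] by blast
  then have "hook_length l i j = p"
    using ij i j by (simp add: hook_length_def arm_eq leg_eq[OF l])
  moreover have "(i, j) \<in> young l" using ij by (simp add: mem_young_iff)
  ultimately show False using no by blast
qed

section \<open>The empty partition and the ends of the bead sequence\<close>

lemma maya_Nil: "maya [] = {..<0}"
proof (intro equalityI subsetI)
  fix x :: int assume "x \<in> {..<0}"
  then have "x = int (part [] (nat (- 1 - x))) - int (nat (- 1 - x)) - 1" by (simp add: part_def)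
  then show "x \<in> maya []" unfolding maya_def by blast
qed (auto simp: maya_def part_def)

lemma runner_maya_Nil:
  assumes "\<gamma> < p"
  shows "runner p \<gamma> (maya []) = {..<0}"
proof -
  have "int \<gamma> + j * int p < 0 \<longleftrightarrow> j < 0" for j
  proof
    assume *: "int \<gamma> + j * int p < 0"
    show "j < 0"
    proof (rule ccontr)
      assume "\<not> j < 0"
      then have "j * int p \<ge> 0" by simp
      with * show False by linarith
    qed
  next
    assume "j < 0"
    \<comment> \<open>From j <= - 1 the position is at most \<gamma> - p, which is negative.\<close>
    then have "(j + 1) * int p \<le> 0" by (intro mult_nonpos_nonneg) auto
    then show "int \<gamma> + j * int p < 0" using assms by (simp add: algebra_simps)
  qed
  then show ?thesis by (simp add: maya_Nil runner_def lessThan_def)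
qed

lemma maya_bounded_above:
  assumes "is_partition l" "z \<in> maya l"
  shows "z < int (part l 0)"
proof -
  obtain i where "z = int (part l i) - int i - 1" using assms(2) by (auto simp: maya_def)
  moreover have "part l i \<le> part l 0" using part_antimono[OF assms(1)] by simp
  ultimately show ?thesis by linarith
qed

lemma maya_below:
  assumes "z < - int (length l)"
  shows "z \<in> maya l"
proof -
  have "z = int (part l (nat (- 1 - z))) - int (nat (- 1 - z)) - 1"
    using assms by (simp add: part_def nat_less_iff)
  then show ?thesis unfolding maya_def by blast
qed

subsection \<open>Charges and cores\<close>

text \<open>The number of non-negative beads minus the number of negative gaps. Asking for the count
  at every n >= N forces all positions below - N to be filled. A relation serves better than a
  function, as not every set of integers has a charge.\<close>

definition has_charge :: "int set \<Rightarrow> int \<Rightarrow> bool" where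
  "has_charge R c \<longleftrightarrow> (\<exists>N. \<forall>n\<ge>N. finite (R \<inter> {-n..}) \<and> int (card (R \<inter> {-n..})) = n + c)"

lemma has_charge_unique: "has_charge R c \<Longrightarrow> has_charge R d \<Longrightarrow> c = d"
proof -
  assume "has_charge R c" "has_charge R d"
  then obtain N M where "\<forall>n\<ge>N. int (card (R \<inter> {-n..})) = n + c" "\<forall>n\<ge>M. int (card (R \<inter> {-n..})) = n + d"
    unfolding has_charge_def by meson
  then have "max N M + c = max N M + d" by (metis max.cobounded1 max.cobounded2)
  then show ?thesis by simp
qed

lemma has_charge_lessThan: "has_charge {..<c} c"
  unfolding has_charge_def
proof (intro exI[of _ "-c"] allI impI)
  fix n assume "n \<ge> - c"
  moreover have "{..<c} \<inter> {-n..} = {-n..<c}" by auto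
  ultimately show "finite ({..<c} \<inter> {-n..}) \<and> int (card ({..<c} \<inter> {-n..})) = n + c" by simp
qed

lemma has_charge_shift:
  assumes "has_charge R c"
  shows "has_charge {z. z - e \<in> R} (c + e)"
proof -
  obtain N where N: "\<And>n. n \<ge> N \<Longrightarrow> finite (R \<inter> {-n..}) \<and> int (card (R \<inter> {-n..})) = n + c"
    using assms unfolding has_charge_def by blast
  show ?thesis unfolding has_charge_def
  proof (intro exI[of _ "N - e"] allI impI)
    fix n assume n: "n \<ge> N - e"
    have eq: "{z. z - e \<in> R} \<inter> {-n..} = (\<lambda>z. z + e) ` (R \<inter> {-(n + e)..})"
    proof (intro equalityI subsetI)
      fix x assume "x \<in> {z. z - e \<in> R} \<inter> {-n..}"
      then show "x \<in> (\<lambda>z. z + e) ` (R \<inter> {-(n + e)..})" by (intro image_eqI[of _ _ "x - e"]) auto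
    qed auto
    show "finite ({z. z - e \<in> R} \<inter> {-n..}) \<and> int (card ({z. z - e \<in> R} \<inter> {-n..})) = n + (c + e)"
      unfolding eq using N[of "n + e"] n by (simp add: card_image)
  qed
qed

text \<open>In a large window from - n to n - 1 there are n + c beads, hence n - c gaps, and the
  reflection turns these gaps into beads.\<close>

lemma has_charge_dual:
  assumes "has_charge R c"
  shows "has_charge {z. - 1 - z \<notin> R} (- c)"
proof -
  obtain N where N: "\<And>n. n \<ge> N \<Longrightarrow> finite (R \<inter> {-n..}) \<and> int (card (R \<inter> {-n..})) = n + c"
    using assms unfolding has_charge_def by blast
  obtain B where B: "\<And>z. z \<in> R \<inter> {-N..} \<Longrightarrow> z \<le> B"
    using N[of N] by (metis Max_ge order.refl)
  show ?thesis unfolding has_charge_def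
  proof (intro exI[of _ "max 0 (max (\<bar>N\<bar> + 1) (B + 1))"] allI impI)
    fix n assume "n \<ge> max 0 (max (\<bar>N\<bar> + 1) (B + 1))"
    then have n: "n \<ge> 0" "n > \<bar>N\<bar>" "n > B" by auto
    \<comment> \<open>A gap at z < - N would leave the count unchanged when the window grows by z,
      whereas the count has to grow by one.\<close>
    have below: "z \<in> R" if "z < - N" for z
    proof (rule ccontr)
      assume "z \<notin> R"
      then have "R \<inter> {- (- z)..} = R \<inter> {- (- z - 1)..}" by (auto simp: order.order_iff_strict)
      then show False using N[of "- z"] N[of "- z - 1"] that by simp
    qed
    have above: "z < n" if "z \<in> R" for z
      using B[of z] n that by (cases "z \<ge> - N") auto
    have eq: "{z. - 1 - z \<notin> R} \<inter> {-n..} = (\<lambda>z. - 1 - z) ` ({-n..<n} - R \<inter> {-n..})"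
    proof (intro equalityI subsetI)
      fix x assume x: "x \<in> {z. - 1 - z \<notin> R} \<inter> {-n..}"
      then have "x < n" using below[of "- 1 - x"] n by (cases "x < n") auto
      with x show "x \<in> (\<lambda>z. - 1 - z) ` ({-n..<n} - R \<inter> {-n..})"
        by (intro image_eqI[of _ _ "- 1 - x"]) auto
    qed auto
    have "card ({-n..<n} - R \<inter> {-n..}) = card {-n..<n} - card (R \<inter> {-n..})"
      using N[of n] n above by (intro card_Diff_subset) auto
    moreover have "card (R \<inter> {-n..}) \<le> card {-n..<n}"
      using above by (intro card_mono) auto
    ultimately have "int (card ({-n..<n} - R \<inter> {-n..})) = 2 * n - (n + c)"
      using N[of n] n by (simp add: of_nat_diff)
    then show "finite ({z. - 1 - z \<notin> R} \<inter> {-n..}) \<and> int (card ({z. - 1 - z \<notin> R} \<inter> {-n..})) = n + - c"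
      unfolding eq by (subst card_image) (auto simp: inj_on_def)
  qed
qed

lemma has_charge_move:
  assumes "has_charge R c" "a \<in> R" "b \<notin> R"
  shows "has_charge (insert b (R - {a})) c"
proof -
  obtain N where N: "\<And>n. n \<ge> N \<Longrightarrow> finite (R \<inter> {-n..}) \<and> int (card (R \<inter> {-n..})) = n + c"
    using assms unfolding has_charge_def by blast
  show ?thesis unfolding has_charge_def
  proof (intro exI[of _ "max N (max (-a) (-b))"] allI impI)
    fix n assume "n \<ge> max N (max (-a) (-b))"
    then have n: "n \<ge> N" "- n \<le> a" "- n \<le> b" by auto
    have eq: "insert b (R - {a}) \<inter> {-n..} = insert b (R \<inter> {-n..} - {a})" using n by auto
    have "card (insert b (R \<inter> {-n..} - {a})) = card (R \<inter> {-n..})"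
      using N[OF n(1)] assms n card_Suc_Diff1[of "R \<inter> {-n..}" a]
      by (subst card_insert_disjoint) auto
    then show "finite (insert b (R - {a}) \<inter> {-n..}) \<and> int (card (insert b (R - {a}) \<inter> {-n..})) = n + c"
      unfolding eq using N[OF n(1)] by simp
  qed
qed

text \<open>Removing the hook moves one bead by one place on a single runner. The charge is carried
  from m back to l because it is known at the core, where the removals end.\<close>

lemma has_charge_runner_removes_hook:
  assumes "is_partition l" "removes_hook p l m" "\<gamma> < p" "has_charge (runner p \<gamma> (maya m)) c"
  shows "has_charge (runner p \<gamma> (maya l)) c"
proof -
  obtain z where z: "z \<in> maya l" "z - int p \<notin> maya l"
    "maya m = insert (z - int p) (maya l - {z})"
    using maya_removes_hook[OF assms(1,2)] by metis
  have p: "p > 0" using assms(3) by simp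
  have l: "maya l = insert z (maya m - {z - int p})" using z p by auto
  show ?thesis
  proof (cases "\<exists>j. z = int \<gamma> + j * int p")
    case True
    then obtain j where j: "z = int \<gamma> + j * int p" by blast
    have e1: "int \<gamma> + i * int p = z \<longleftrightarrow> i = j" for i using j p by simp
    have "z - int p = int \<gamma> + (j - 1) * int p" using j by (simp add: algebra_simps)
    then have e2: "int \<gamma> + i * int p = z - int p \<longleftrightarrow> i = j - 1" for i using p by simp
    have "runner p \<gamma> (maya l) = insert j (runner p \<gamma> (maya m) - {j - 1})"
      unfolding l runner_def by (auto simp: e1 e2)
    moreover have "j - 1 \<in> runner p \<gamma> (maya m)" "j \<notin> runner p \<gamma> (maya m)"
      using z p by (auto simp: runner_def e1 e2)
    ultimately show ?thesis using has_charge_move[OF assms(4)] by simp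
  next
    case False
    have "int \<gamma> + j * int p \<noteq> z - int p" for j
    proof
      assume "int \<gamma> + j * int p = z - int p"
      then have "z = int \<gamma> + (j + 1) * int p" by (simp add: algebra_simps)
      then show False using False by blast
    qed
    then have "runner p \<gamma> (maya l) = runner p \<gamma> (maya m)"
      unfolding l runner_def using False by auto
    then show ?thesis using assms(4) by simp
  qed
qed

lemma is_core_is_partition:
  assumes "is_partition l" "is_core p l c"
  shows "is_partition c"
proof -
  have "(removes_hook p)\<^sup>*\<^sup>* l c" using assms(2) by (simp add: is_core_def)
  then show ?thesis using assms(1) by (cases rule: rtranclp.cases) (auto simp: removes_hook_def)
qed

text \<open>Without hooks of length p a runner is closed downwards. Being non-empty and bounded
  above, it is a half line, whose charge is its end point.\<close>

lemma is_core_charge: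
  assumes l: "is_partition l" and core: "is_core p l c" and "\<gamma> < p"
  obtains e where "runner p \<gamma> (maya c) = {..<e}" "has_charge (runner p \<gamma> (maya l)) e"
proof -
  have rt: "(removes_hook p)\<^sup>*\<^sup>* l c" and no: "\<forall>(i, j)\<in>young c. hook_length c i j \<noteq> p"
    using core by (auto simp: is_core_def)
  have c: "is_partition c" by (rule is_core_is_partition[OF l core])
  have p: "p > 0" using assms(3) by simp
  let ?R = "runner p \<gamma> (maya c)"
  have down1: "j - 1 \<in> ?R" if "j \<in> ?R" for j
    using maya_no_hook_closed[OF c p no] that by (force simp: runner_def algebra_simps)
  have down: "i \<in> ?R" if "j \<in> ?R" "i \<le> j" for i j
    using that(2,1) by (induction rule: int_le_induct) (auto intro: down1)
  have bd: "j < int (part c 0)" if "j \<in> ?R" for j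
  proof (rule ccontr)
    assume "\<not> j < int (part c 0)"
    then have "int (part c 0) * int 1 \<le> j * int p" using p by (intro mult_mono) auto
    then show False using maya_bounded_above[OF c, of "int \<gamma> + j * int p"] that by (simp add: runner_def)
  qed
  \<comment> \<open>This place of the runner lies at \<gamma> - (k + 1) p < - k with k =
    \<open>length c\<close>, where every position is filled.\<close>
  have ne: "- int (length c) - 1 \<in> ?R"
  proof -
    have "(int (length c) + 1) * int p \<ge> int (length c) * 1 + int p"
      using p mult_left_mono[of 1 "int p" "int (length c)"] by (simp add: algebra_simps)
    then show ?thesis using \<open>\<gamma> < p\<close> by (auto simp: runner_def algebra_simps intro!: maya_below)
  qed
  let ?b = "- int (length c) - 1"
  have "\<exists>e. e \<in> ?R \<and> e + 1 \<notin> ?R"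
  proof (rule ccontr)
    assume "\<nexists>e. e \<in> ?R \<and> e + 1 \<notin> ?R"
    then have up: "e + 1 \<in> ?R" if "e \<in> ?R" for e using that by blast
    have "e \<in> ?R" if "?b \<le> e" for e
      using that by (induction rule: int_ge_induct) (use ne up in auto)
    from this[of "int (part c 0)"] show False using bd by fastforce
  qed
  then obtain e where e: "e \<in> ?R" "e + 1 \<notin> ?R" by blast
  have R: "?R = {..<e + 1}"
  proof (intro set_eqI)
    fix j
    show "j \<in> ?R \<longleftrightarrow> j \<in> {..<e + 1}" using down[of e j] down[of j "e + 1"] e by (cases "j \<le> e") auto
  qed
  have "has_charge (runner p \<gamma> (maya l)) (e + 1)"
    using rt l
  proof (induction rule: converse_rtranclp_induct)
    case base
    then show ?case using R has_charge_lessThan by simp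
  next
    case (step y z)
    then show ?case using has_charge_runner_removes_hook[OF _ _ \<open>\<gamma> < p\<close>] by (auto simp: removes_hook_def)
  qed
  with R show ?thesis by (rule that)
qed

subsection \<open>Quotients\<close>

lemma beta_numbers_pad:
  "beta_numbers (l @ replicate m 0) =
    (\<lambda>i. part l i + (length l + m) - (i + 1)) ` {..<length l + m}"
proof -
  have "beta_numbers (l @ replicate m 0) =
      (\<lambda>i. (l @ replicate m 0) ! i + (length l + m) - (i + 1)) ` {..<length l + m}"
    by (simp only: beta_numbers_def length_append length_replicate image_def Bex_def lessThan_iff
        conj_commute)
  also have "\<dots> = (\<lambda>i. part l i + (length l + m) - (i + 1)) ` {..<length l + m}"
    by (rule image_cong) (auto simp: part_def nth_append)
  finally show ?thesis .
qed

text \<open>A beta set with k parts is the portion of \<open>maya l\<close> from - k upwards,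
  shifted by k. The rows from k on have length 0 and only supply beads below - k.\<close>

lemma mem_beta_numbers_pad_iff:
  "x \<in> beta_numbers (l @ replicate m 0) \<longleftrightarrow> int x - int (length l + m) \<in> maya l"
proof
  let ?k = "length l + m"
  assume "x \<in> beta_numbers (l @ replicate m 0)"
  then obtain i where i: "i < ?k" "x = part l i + ?k - (i + 1)"
    unfolding beta_numbers_pad by (elim imageE) simp
  then have "int x - int ?k = int (part l i) - int i - 1" by linarith
  then show "int x - int ?k \<in> maya l" by (simp add: maya_def)
next
  let ?k = "length l + m"
  assume "int x - int ?k \<in> maya l"
  then obtain i where i: "int x - int ?k = int (part l i) - int i - 1" by (auto simp: maya_def)
  have ik: "i < ?k"
  proof (rule ccontr)
    assume "\<not> i < ?k"
    then show False using i by (simp add: part_def)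
  qed
  moreover have "x = part l i + ?k - (i + 1)" using i ik by linarith
  ultimately show "x \<in> beta_numbers (l @ replicate m 0)"
    unfolding beta_numbers_pad by (intro image_eqI[of _ _ i]) simp_all
qed

lemma card_beta_numbers_pad:
  assumes "is_partition l"
  shows "card (beta_numbers (l @ replicate m 0)) = length l + m"
proof -
  let ?k = "length l + m"
  have "inj_on (\<lambda>i. part l i + ?k - (i + 1)) {..<?k}"
  proof (rule inj_onI)
    fix a b assume "a \<in> {..<?k}" "b \<in> {..<?k}" "part l a + ?k - (a + 1) = part l b + ?k - (b + 1)"
    then show "a = b"
      using part_antimono[OF assms, of a b] part_antimono[OF assms, of b a]
      by (cases a b rule: linorder_cases) auto
  qed
  then show ?thesis by (simp add: card_image beta_numbers_pad)
qed

text \<open>The number of parts behind X is p * k, so passing from X to \<open>maya l\<close> shifts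
  every runner by k along itself. The total shift e also involves the number of zero parts used for
  the quotient, which is free; charges will determine it.\<close>

lemma is_quotient_runner:
  assumes l: "is_partition l" and quot: "is_quotient p l q" and "\<gamma> < p"
  obtains e where "runner p \<gamma> (maya l) = {z. z - e \<in> maya (q ! \<gamma>)}"
proof -
  obtain X where X: "is_beta_set l X" "[card X = 0] (mod p)" "is_beta_set (q ! \<gamma>) {j. \<gamma> + j * p \<in> X}"
    using quot \<open>\<gamma> < p\<close> by (auto simp: is_quotient_def)
  obtain m where m: "X = beta_numbers (l @ replicate m 0)" using X by (auto simp: is_beta_set_def)
  obtain n where q: "is_partition (q ! \<gamma>)"
    and n: "{j. \<gamma> + j * p \<in> X} = beta_numbers (q ! \<gamma> @ replicate n 0)"
    using X by (auto simp: is_beta_set_def)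
  have "p dvd length l + m" using X(2) card_beta_numbers_pad[OF l] m by (simp add: cong_0_iff)
  then obtain k where k: "length l + m = p * k" by blast
  let ?K = "length (q ! \<gamma>) + n"
  \<comment> \<open>Beta sets speak only of j >= 0. For j < 0 the positions on both sides are
    filled.\<close>
  have mem: "j - int ?K \<in> maya (q ! \<gamma>) \<longleftrightarrow> j - int k \<in> runner p \<gamma> (maya l)" for j
  proof (cases "j \<ge> 0")
    case True
    then obtain i where i: "j = int i" using nonneg_int_cases by blast
    have "j - int ?K \<in> maya (q ! \<gamma>) \<longleftrightarrow> \<gamma> + i * p \<in> X"
      using n mem_beta_numbers_pad_iff[of i "q ! \<gamma>" n] i by auto
    also have "\<dots> \<longleftrightarrow> int (\<gamma> + i * p) - int (p * k) \<in> maya l"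
      unfolding m mem_beta_numbers_pad_iff k ..
    also have "\<dots> \<longleftrightarrow> j - int k \<in> runner p \<gamma> (maya l)"
      by (simp add: runner_def i algebra_simps)
    finally show ?thesis .
  next
    case False
    then have "(j + 1) * int p \<le> 0" by (intro mult_nonpos_nonneg) auto
    then have "int \<gamma> + (j - int k) * int p < - int (p * k)"
      using \<open>\<gamma> < p\<close> by (simp add: algebra_simps)
    also have "\<dots> \<le> - int (length l)" using k by linarith
    finally have "j - int k \<in> runner p \<gamma> (maya l)" by (auto simp: runner_def intro: maya_below)
    moreover have "j - int ?K \<in> maya (q ! \<gamma>)" using False by (intro maya_below) simp
    ultimately show ?thesis by simp
  qed
  have "runner p \<gamma> (maya l) = {z. z - (int ?K - int k) \<in> maya (q ! \<gamma>)}"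
  proof (intro set_eqI)
    fix z
    show "z \<in> runner p \<gamma> (maya l) \<longleftrightarrow> z \<in> {z. z - (int ?K - int k) \<in> maya (q ! \<gamma>)}"
      using mem[of "z + int k"] by (simp add: algebra_simps)
  qed
  then show ?thesis by (rule that)
qed

text \<open>The symmetry of the core is available on beads only. It makes arm and leg agree on the
  diagonal, so that \<open>core_d\<close> counts the non-negative places of the half line below e,
  none if e is negative.\<close>

lemma core_d_runner:
  assumes c: "is_partition c" and sym: "\<And>z. - 1 - z \<in> maya c \<longleftrightarrow> z \<notin> maya c"
    and e: "runner p \<gamma> (maya c) = {..<e}" and "\<gamma> < p"
  shows "core_d p c \<gamma> = nat e"
proof -
  have p: "p > 0" using assms(4) by simp
  have "leg c i i = arm c i i" if "i < part c i" for i
    using maya_symmetric_imp_arm_eq_leg[OF c sym that] by simp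
  then have "(b, b) \<in> diag c \<longleftrightarrow> b \<in> diag_R c" for b
    by (force simp: diag_R_def diag_def mem_young_iff)
  then have "core_diag p c \<gamma> = (\<lambda>b. (b, b)) ` {b. int b \<in> maya c \<and> b mod p = \<gamma>}"
    using assms(4) by (auto simp: core_diag_def mem_diag_R_iff cong_def)
  also have "{b. int b \<in> maya c \<and> b mod p = \<gamma>} = (\<lambda>j. \<gamma> + j * p) ` {..<nat e}"
  proof -
    have mem: "int (\<gamma> + j * p) \<in> maya c \<longleftrightarrow> j < nat e" for j
    proof -
      have "int (\<gamma> + j * p) \<in> maya c \<longleftrightarrow> int j \<in> runner p \<gamma> (maya c)" by (simp add: runner_def)
      also have "\<dots> \<longleftrightarrow> j < nat e" unfolding e lessThan_iff by linarith
      finally show ?thesis .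
    qed
    have "b \<in> (\<lambda>j. \<gamma> + j * p) ` {..<nat e}" if "int b \<in> maya c" "b mod p = \<gamma>" for b
    proof -
      have b: "b = \<gamma> + b div p * p" using that(2) by (metis mod_div_mult_eq)
      then have "b div p \<in> {..<nat e}" using that(1) mem[of "b div p"] by simp
      with b show ?thesis by (rule image_eqI)
    qed
    moreover have "int (\<gamma> + j * p) \<in> maya c \<and> (\<gamma> + j * p) mod p = \<gamma>" if "j < nat e" for j
      using that mem[of j] assms(4) by simp
    ultimately show ?thesis by blast
  qed
  finally show ?thesis using p by (simp add: core_d_def card_image inj_on_def)
qed

section \<open>The sign of the charge and the four sets\<close>

theorem theorem8p4:
  fixes p :: nat and l l0 lb :: "nat list" and q :: "nat list list"
  assumes "prime p"
    and "symmetric_partition l"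
    and "is_core p l l0" and "l0 \<noteq> []"
    and "is_quotient p l q"
    and "symmetric_partition lb"
    and "is_core p lb []"
    and "is_quotient p lb q"
  shows "diag_hook_lengths l =
      (\<Union>\<gamma>\<in>Omega1 p l0. {2 * (\<gamma> + (\<sigma> + core_d p l0 \<gamma>) * p) + 1 | \<sigma>. \<sigma> \<in> res_R p lb \<gamma>})
    \<union> (\<Union>\<gamma>\<in>Omega1 p l0. {2 * (\<gamma> + (core_d p l0 \<gamma> - s - 1) * p) + 1 | s. s \<in> S_L p l0 lb \<gamma>})
    \<union> (\<Union>\<gamma>\<in>Omega1 p l0. {2 * ((p - 1 - \<gamma>) + (t - core_d p l0 \<gamma>) * p) + 1 | t. t \<in> T_L p l0 lb \<gamma>})
    \<union> (\<Union>\<gamma>\<in>Omega2 p l0. {2 * (\<gamma> + \<mu> * p) + 1 | \<mu>. \<mu> \<in> res_R p lb \<gamma>})"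
    (is "_ = ?O1 \<union> ?O2 \<union> ?O3 \<union> ?O4")
proof -
  have l: "is_partition l" and lb: "is_partition lb"
    using assms by (auto simp: symmetric_partition_def)
  have p: "p > 0" using assms(1) by (simp add: prime_gt_0_nat)
  have l0: "is_partition l0" by (rule is_core_is_partition[OF l assms(3)])
  have "\<exists>e. runner p \<gamma> (maya l0) = {..<e} \<and>
      runner p \<gamma> (maya l) = {z. z - e \<in> runner p \<gamma> (maya lb)} \<and> has_charge (runner p \<gamma> (maya l)) e"
    if \<gamma>: "\<gamma> < p" for \<gamma>
  proof -
    obtain e where e: "runner p \<gamma> (maya l0) = {..<e}" "has_charge (runner p \<gamma> (maya l)) e"
      using is_core_charge[OF l assms(3) \<gamma>] by metis
    obtain e' where e': "runner p \<gamma> (maya []) = {..<e'}" "has_charge (runner p \<gamma> (maya lb)) e'"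
      using is_core_charge[OF lb assms(7) \<gamma>] by metis
    have "{..<e'} = {..<0}" using e'(1) runner_maya_Nil[OF \<gamma>] by simp
    \<comment> \<open>The core of \<open>lb\<close> is empty, so all its runners have charge 0, and
      the relative shift f - f' is the charge of the runner of l.\<close>
    then have "e' = 0" by (simp only: lessThan_eq_iff)
    obtain f where f: "runner p \<gamma> (maya l) = {z. z - f \<in> maya (q ! \<gamma>)}"
      using is_quotient_runner[OF l assms(5) \<gamma>] by metis
    obtain f' where f': "runner p \<gamma> (maya lb) = {z. z - f' \<in> maya (q ! \<gamma>)}"
      using is_quotient_runner[OF lb assms(8) \<gamma>] by metis
    have shift: "runner p \<gamma> (maya l) = {z. z - (f - f') \<in> runner p \<gamma> (maya lb)}"
      unfolding f f' by (simp add: algebra_simps)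
    have "has_charge (runner p \<gamma> (maya l)) (f - f')"
      using has_charge_shift[OF e'(2), of "f - f'"] \<open>e' = 0\<close> unfolding shift by simp
    then have "e = f - f'" by (rule has_charge_unique[OF e(2)])
    then show ?thesis using e shift by blast
  qed
  then obtain c where core: "\<And>\<gamma>. \<gamma> < p \<Longrightarrow> runner p \<gamma> (maya l0) = {..<c \<gamma>}"
    and shift: "\<And>\<gamma>. \<gamma> < p \<Longrightarrow> runner p \<gamma> (maya l) = {z. z - c \<gamma> \<in> runner p \<gamma> (maya lb)}"
    and charge: "\<And>\<gamma>. \<gamma> < p \<Longrightarrow> has_charge (runner p \<gamma> (maya l)) (c \<gamma>)"
    by metis
  define bead where "bead \<gamma> m \<longleftrightarrow> int \<gamma> + m * int p \<in> maya lb" for \<gamma> m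
  \<comment> \<open>The reflection exchanges the runners \<gamma> and p - 1 - \<gamma> and reflects
    the places on them.\<close>
  have dual: "- 1 - (int \<gamma> + j * int p) = int (p - 1 - \<gamma>) + (- 1 - j) * int p" if "\<gamma> < p" for \<gamma> j
    using that by (simp add: of_nat_diff algebra_simps)
  have c_dual: "c (p - 1 - \<gamma>) = - c \<gamma>" if "\<gamma> < p" for \<gamma>
  proof -
    have "runner p (p - 1 - \<gamma>) (maya l) = {z. - 1 - z \<notin> runner p \<gamma> (maya l)}"
    proof (intro set_eqI)
      fix z
      show "z \<in> runner p (p - 1 - \<gamma>) (maya l) \<longleftrightarrow> z \<in> {z. - 1 - z \<notin> runner p \<gamma> (maya l)}"
        using dual[OF that, of "- 1 - z"] symmetric_partition_maya[OF assms(2), of "int \<gamma> + (- 1 - z) * int p"]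
        by (simp add: runner_def)
    qed
    then have "has_charge (runner p (p - 1 - \<gamma>) (maya l)) (- c \<gamma>)"
      using has_charge_dual[OF charge[OF that]] by simp
    then show ?thesis using charge[of "p - 1 - \<gamma>"] p by (intro has_charge_unique) auto
  qed
  have core_mem: "int \<gamma> + j * int p \<in> maya l0 \<longleftrightarrow> j < c \<gamma>" if "\<gamma> < p" for \<gamma> j
    using core[OF that] by (auto simp: runner_def)
  \<comment> \<open>The core inherits the symmetry of l, since its half lines are given by the
    charges and these change sign under reflection.\<close>
  have "- 1 - z \<in> maya l0 \<longleftrightarrow> z \<notin> maya l0" for z
  proof -
    define \<gamma> j where "\<gamma> = nat (z mod int p)" and "j = z div int p"
    have \<gamma>: "\<gamma> < p" using p by (simp add: \<gamma>_def nat_less_iff)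
    have "z = int \<gamma> + j * int p" using p by (simp add: \<gamma>_def j_def)
    then show ?thesis
      using dual[OF \<gamma>, of j] core_mem[OF \<gamma>, of j] core_mem[of "p - 1 - \<gamma>" "- 1 - j"] c_dual[OF \<gamma>] p
      by auto
  qed
  then have d: "core_d p l0 \<gamma> = nat (c \<gamma>)" if "\<gamma> < p" for \<gamma>
    using core_d_runner[OF l0 _ core[OF that] that] by blast
  have O1: "\<gamma> \<in> Omega1 p l0 \<longleftrightarrow> \<gamma> < p \<and> c \<gamma> > 0" for \<gamma>
    using d by (auto simp: Omega1_def)
  have O1s: "\<gamma> \<in> Omega1_star p l0 \<longleftrightarrow> \<gamma> < p \<and> c \<gamma> < 0" for \<gamma>
  proof
    assume "\<gamma> \<in> Omega1_star p l0"
    then show "\<gamma> < p \<and> c \<gamma> < 0" using O1 c_dual p by (auto simp: Omega1_star_def)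
  next
    assume "\<gamma> < p \<and> c \<gamma> < 0"
    then have "p - 1 - \<gamma> \<in> Omega1 p l0" "\<gamma> = p - 1 - (p - 1 - \<gamma>)" using O1 c_dual[of \<gamma>] by auto
    then show "\<gamma> \<in> Omega1_star p l0" unfolding Omega1_star_def by blast
  qed
  have O2: "\<gamma> \<in> Omega2 p l0 \<longleftrightarrow> \<gamma> < p \<and> c \<gamma> = 0" for \<gamma>
    unfolding Omega2_def Diff_iff Un_iff O1 O1s by auto
  have R: "m \<in> res_R p lb \<gamma> \<longleftrightarrow> bead \<gamma> (int m)" for m \<gamma>
    by (simp add: res_R_def mem_diag_R_iff bead_def)
  \<comment> \<open>Two readings of \<open>res_L\<close>: as gaps on the runner \<gamma>, for the
    second set, and by symmetry of \<open>lb\<close> as beads on the opposite runner, for the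
    third.\<close>
  have L: "m \<in> res_L p lb \<gamma> \<longleftrightarrow> \<not> bead \<gamma> (- 1 - int m)" if "\<gamma> < p" for m \<gamma>
  proof -
    have "- 1 - int ((p - 1 - \<gamma>) + m * p) = int \<gamma> + (- 1 - int m) * int p"
      using that by (simp add: of_nat_diff algebra_simps)
    then show ?thesis by (simp add: res_L_def mem_diag_L_iff[OF lb] bead_def)
  qed
  have L': "m \<in> res_L p lb \<gamma> \<longleftrightarrow> bead (p - 1 - \<gamma>) (int m)" for m \<gamma>
    by (simp add: res_L_def symmetric_partition_diag_L_eq_diag_R[OF assms(6)] mem_diag_R_iff bead_def)
  have diag: "\<gamma> + j * p \<in> diag_R l \<longleftrightarrow> bead \<gamma> (int j - c \<gamma>)" if "\<gamma> < p" for \<gamma> j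
  proof -
    have "\<gamma> + j * p \<in> diag_R l \<longleftrightarrow> int j \<in> runner p \<gamma> (maya l)"
      by (simp add: mem_diag_R_iff runner_def)
    also have "\<dots> \<longleftrightarrow> bead \<gamma> (int j - c \<gamma>)"
      unfolding shift[OF that] by (simp add: bead_def runner_def)
    finally show ?thesis .
  qed
  have hook: "2 * (\<gamma> + j * p) + 1 \<in> diag_hook_lengths l \<longleftrightarrow> bead \<gamma> (int j - c \<gamma>)" if "\<gamma> < p" for \<gamma> j
  proof -
    have "2 * b + 1 \<in> diag_hook_lengths l \<longleftrightarrow> b \<in> diag_R l" for b
      by (simp add: symmetric_partition_diag_hook_lengths[OF assms(2)])
    then show ?thesis using diag[OF that] by blast
  qed
  show ?thesis
  proof (intro equalityI subsetI)
    fix x assume x: "x \<in> diag_hook_lengths l"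
    then obtain b where "x = 2 * b + 1" by (auto simp: symmetric_partition_diag_hook_lengths[OF assms(2)])
    define \<gamma> j where "\<gamma> = b mod p" and "j = b div p"
    have xj: "x = 2 * (\<gamma> + j * p) + 1" using \<open>x = 2 * b + 1\<close> by (simp add: \<gamma>_def j_def)
    have \<gamma>: "\<gamma> < p" using p by (simp add: \<gamma>_def)
    have bead: "bead \<gamma> (int j - c \<gamma>)" using x hook[OF \<gamma>] unfolding xj by blast
    \<comment> \<open>The place before the shift is j - c \<gamma>. The second case has positive
      charge because j >= 0.\<close>
    consider "c \<gamma> > 0" "c \<gamma> \<le> int j" | "int j < c \<gamma>" | "c \<gamma> < 0" | "c \<gamma> = 0" by linarith
    then show "x \<in> ?O1 \<union> ?O2 \<union> ?O3 \<union> ?O4"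
    proof cases
      case 1
      define \<sigma> where "\<sigma> = j - nat (c \<gamma>)"
      have \<sigma>: "int \<sigma> = int j - c \<gamma>" and j: "\<sigma> + core_d p l0 \<gamma> = j"
        using 1 d[OF \<gamma>] by (auto simp: \<sigma>_def)
      have "x = 2 * (\<gamma> + (\<sigma> + core_d p l0 \<gamma>) * p) + 1" unfolding j by (rule xj)
      moreover have "\<sigma> \<in> res_R p lb \<gamma>" unfolding R \<sigma> by (rule bead)
      moreover have "\<gamma> \<in> Omega1 p l0" using O1 \<gamma> 1 by simp
      ultimately show ?thesis by blast
    next
      case 2
      \<comment> \<open>The place before the shift is negative and equals - 1 - s, so this bead of
        \<open>lb\<close> says that s is not in \<open>res_L\<close>.\<close>
      define s where "s = nat (c \<gamma>) - 1 - j"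
      have s: "- 1 - int s = int j - c \<gamma>" and j: "core_d p l0 \<gamma> - s - 1 = j"
        and "s < core_d p l0 \<gamma>"
        using 2 d[OF \<gamma>] by (auto simp: s_def)
      have "x = 2 * (\<gamma> + (core_d p l0 \<gamma> - s - 1) * p) + 1" unfolding j by (rule xj)
      moreover have "s \<notin> res_L p lb \<gamma>" unfolding L[OF \<gamma>] s using bead by blast
      then have "s \<in> S_L p l0 lb \<gamma>" using \<open>s < core_d p l0 \<gamma>\<close> by (simp add: S_L_def)
      moreover have "\<gamma> \<in> Omega1 p l0" using O1 \<gamma> 2 by simp
      ultimately show ?thesis by blast
    next
      case 3
      \<comment> \<open>A runner of negative charge is indexed by its opposite runner, which belongs
        to \<open>Omega1\<close>.\<close>
      define \<gamma>' t where "\<gamma>' = p - 1 - \<gamma>" and "t = j + nat (- c \<gamma>)"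
      have \<gamma>': "\<gamma>' < p" "p - 1 - \<gamma>' = \<gamma>" "c \<gamma>' = - c \<gamma>" using \<gamma> c_dual[OF \<gamma>] by (auto simp: \<gamma>'_def)
      have t: "int t = int j - c \<gamma>" and j: "t - core_d p l0 \<gamma>' = j" and "t \<ge> core_d p l0 \<gamma>'"
        using 3 d[OF \<gamma>'(1)] \<gamma>'(3) by (auto simp: t_def)
      have "x = 2 * ((p - 1 - \<gamma>') + (t - core_d p l0 \<gamma>') * p) + 1"
        unfolding j \<gamma>'(2) by (rule xj)
      moreover have "t \<in> res_L p lb \<gamma>'" unfolding L' \<gamma>'(2) t by (rule bead)
      then have "t \<in> T_L p l0 lb \<gamma>'" using \<open>t \<ge> core_d p l0 \<gamma>'\<close> by (simp add: T_L_def)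
      moreover have "\<gamma>' \<in> Omega1 p l0" using O1 \<gamma>' 3 by simp
      ultimately show ?thesis by blast
    next
      case 4
      then have "j \<in> res_R p lb \<gamma>" and \<gamma>2: "\<gamma> \<in> Omega2 p l0" using bead R O2 \<gamma> by auto
      then have "x \<in> {2 * (\<gamma> + \<mu> * p) + 1 | \<mu>. \<mu> \<in> res_R p lb \<gamma>}" using xj by blast
      then show ?thesis by (intro UnI2 UN_I[OF \<gamma>2])
    qed
  next
    fix x assume "x \<in> ?O1 \<union> ?O2 \<union> ?O3 \<union> ?O4"
    then consider
        \<gamma> \<sigma> where "\<gamma> \<in> Omega1 p l0" "x = 2 * (\<gamma> + (\<sigma> + core_d p l0 \<gamma>) * p) + 1" "\<sigma> \<in> res_R p lb \<gamma>"
      | \<gamma> s where "\<gamma> \<in> Omega1 p l0" "x = 2 * (\<gamma> + (core_d p l0 \<gamma> - s - 1) * p) + 1" "s \<in> S_L p l0 lb \<gamma>"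
      | \<gamma> t where "\<gamma> \<in> Omega1 p l0" "x = 2 * ((p - 1 - \<gamma>) + (t - core_d p l0 \<gamma>) * p) + 1" "t \<in> T_L p l0 lb \<gamma>"
      | \<gamma> \<mu> where "\<gamma> \<in> Omega2 p l0" "x = 2 * (\<gamma> + \<mu> * p) + 1" "\<mu> \<in> res_R p lb \<gamma>"
      by (elim UnE UN_E CollectE exE conjE)
    then show "x \<in> diag_hook_lengths l"
    proof cases
      case 1
      then have \<gamma>: "\<gamma> < p" "c \<gamma> > 0" using O1 by auto
      have "int (\<sigma> + core_d p l0 \<gamma>) - c \<gamma> = int \<sigma>" using \<gamma> d by simp
      then show ?thesis using 1 R hook[OF \<gamma>(1)] by metis
    next
      case 2
      then have \<gamma>: "\<gamma> < p" "c \<gamma> > 0" using O1 by auto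
      have "s < core_d p l0 \<gamma>" "s \<notin> res_L p lb \<gamma>" using 2 by (auto simp: S_L_def)
      then have "int (core_d p l0 \<gamma> - s - 1) - c \<gamma> = - 1 - int s" "bead \<gamma> (- 1 - int s)"
        using \<gamma> d L by auto
      then show ?thesis using 2(2) hook[OF \<gamma>(1)] by metis
    next
      case 3
      then have \<gamma>: "\<gamma> < p" "c \<gamma> > 0" using O1 by auto
      have "p - 1 - \<gamma> < p" using p by simp
      have "t \<ge> core_d p l0 \<gamma>" "t \<in> res_L p lb \<gamma>" using 3 by (auto simp: T_L_def)
      \<comment> \<open>By t >= \<open>core_d p l0 \<gamma>\<close> the subtraction is exact, and
        the opposite charge restores t.\<close>
      then have "int (t - core_d p l0 \<gamma>) - c (p - 1 - \<gamma>) = int t" "bead (p - 1 - \<gamma>) (int t)"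
        using \<gamma> d[OF \<gamma>(1)] L' c_dual[OF \<gamma>(1)] by (auto simp: of_nat_diff)
      then show ?thesis using 3(2) hook[OF \<open>p - 1 - \<gamma> < p\<close>] by metis
    next
      case 4
      then have \<gamma>: "\<gamma> < p" "c \<gamma> = 0" using O2 by blast+
      have "bead \<gamma> (int \<mu> - c \<gamma>)" using 4(3) unfolding R \<gamma>(2) by simp
      then show ?thesis unfolding 4(2) hook[OF \<gamma>(1)] .
    qed
  qed
qed

end
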